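(* Let $n\ge 1$ and let $i,j$ be integers with $0\le i\le j\le n$ and $i+j\le n$. If $f\in U_{[i,j]}(n,2)$ and $f\not\equiv 0$, then $$|f|\ge 2^{n-j}.$$ Moreover, this bound is sharp: for all such $n,i,j$ there exists $f\in U_{[i,j]}(n,2)$, $f\not\equiv 0$, with $|f|=2^{n-j}$.
   Context: For $q\ge 2$ let $\Sigma_q=\{0,1,\ldots,q-1\}$. The Hamming graph $H(n,q)$ has vertex set $\Sigma_q^n$, and two vertices are adjacent if they differ in exactly one coordinate. The eigenvalues of its adjacency matrix are $\lambda_i(n,q)=n(q-1)-q\cdot i$ for $0\le i\le n$. Let $U_i(n,q)$ be the $\lambda_i(n,q)$-eigenspace, i.e. the space of functions $f:\Sigma_q^n\to\mathbb{R}$ with $\lambda_i(n,q)f(x)=\sum_{y\in N(x)}f(y)$ for every vertex $x$, where $N(x)$ is the set of neighbors of $x$. For $0\le i\le j\le n$ let $U_{[i,j]}(n,q)=U_i(n,q)\oplus U_{i+1}(n,q)\oplus\cdots\oplus U_j(n,q)$. For a function $f:\Sigma_q^n\to\mathbb{R}$, $|f|$ denotes the cardinality of its support $\{x : f(x)\ne 0\}$. *)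

theory Defs
  imports Complex_Main
begin

text \<open>
  Words of length \<open>n\<close> over \<open>{0, \<dots>, q - 1}\<close> are lists. Real functions on words
  are total on \<open>nat list\<close>, normalised to be \<open>0\<close> off the vertex set, so that distinct
  HOL functions represent distinct functions on the vertices.
\<close>

definition hamming_verts :: "nat \<Rightarrow> nat \<Rightarrow> nat list set" where
  "hamming_verts n q = {x. length x = n \<and> set x \<subseteq> {0..<q}}"

definition hamming_adj :: "nat \<Rightarrow> nat list \<Rightarrow> nat list \<Rightarrow> bool" where
  "hamming_adj n x y \<longleftrightarrow> card {k. k < n \<and> x ! k \<noteq> y ! k} = 1"

definition hamming_nbrs :: "nat \<Rightarrow> nat \<Rightarrow> nat list \<Rightarrow> nat list set" where
  "hamming_nbrs n q x = {y \<in> hamming_verts n q. hamming_adj n x y}"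

definition hamming_eigenvalue :: "nat \<Rightarrow> nat \<Rightarrow> nat \<Rightarrow> real" where
  "hamming_eigenvalue n q i = real n * (real q - 1) - real q * real i"

definition hamming_funs :: "nat \<Rightarrow> nat \<Rightarrow> (nat list \<Rightarrow> real) set" where
  "hamming_funs n q = {f. \<forall>x. x \<notin> hamming_verts n q \<longrightarrow> f x = 0}"

definition hamming_eigenspace :: "nat \<Rightarrow> nat \<Rightarrow> nat \<Rightarrow> (nat list \<Rightarrow> real) set" where
  "hamming_eigenspace n q i =
     {f \<in> hamming_funs n q. \<forall>x \<in> hamming_verts n q.
        hamming_eigenvalue n q i * f x = (\<Sum>y \<in> hamming_nbrs n q x. f y)}"

text \<open>
  The sum of the eigenspaces with indices in \<open>{i..j}\<close>; it is direct by
  \<open>hamming_eigenspaces_independent\<close> below.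
\<close>

definition hamming_eigensum :: "nat \<Rightarrow> nat \<Rightarrow> nat \<Rightarrow> nat \<Rightarrow> (nat list \<Rightarrow> real) set" where
  "hamming_eigensum n q i j =
     {f. \<exists>g. (\<forall>k \<in> {i..j}. g k \<in> hamming_eigenspace n q k) \<and> f = (\<lambda>x. \<Sum>k \<in> {i..j}. g k x)}"

definition hamming_support :: "nat \<Rightarrow> nat \<Rightarrow> (nat list \<Rightarrow> real) \<Rightarrow> nat list set" where
  "hamming_support n q f = {x \<in> hamming_verts n q. f x \<noteq> 0}"

lemma finite_hamming_verts: "finite (hamming_verts n q)"
  using finite_lists_length_eq[of "{0..<q}" n]
  by (simp add: hamming_verts_def conj_commute)

lemma hamming_eigenspaces_independent:
  assumes "q > 0" "finite K"
    and "\<And>k. k \<in> K \<Longrightarrow> g k \<in> hamming_eigenspace n q k"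
    and "\<And>x. (\<Sum>k \<in> K. g k x) = 0"
    and "k \<in> K"
  shows "g k x = 0"
  using assms(2-)
proof (induction K arbitrary: g k x rule: finite_induct)
  case empty
  then show ?case by simp
next
  case (insert m K)
  let ?ev = "hamming_eigenvalue n q"
  define h where "h k x = (?ev k - ?ev m) * g k x" for k x
  have eig: "?ev k * g k x = (\<Sum>y \<in> hamming_nbrs n q x. g k y)"
    if "k \<in> insert m K" "x \<in> hamming_verts n q" for k x
    using insert.prems(1) that by (simp add: hamming_eigenspace_def)
  have off: "g k x = 0" if "k \<in> insert m K" "x \<notin> hamming_verts n q" for k x
    using insert.prems(1) that by (simp add: hamming_eigenspace_def hamming_funs_def)
  have "h k \<in> hamming_eigenspace n q k" if "k \<in> K" for k
    using off eig that
    by (auto simp: hamming_eigenspace_def hamming_funs_def h_def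
        sum_distrib_left[symmetric] mult.left_commute)
  moreover have "(\<Sum>k \<in> K. h k x) = 0" for x
  proof (cases "x \<in> hamming_verts n q")
    case True
    have "(\<Sum>k \<in> insert m K. ?ev k * g k x)
        = (\<Sum>y \<in> hamming_nbrs n q x. \<Sum>k \<in> insert m K. g k y)"
      using True by (subst sum.swap) (intro sum.cong refl eig)
    also have "\<dots> = 0"
      by (simp only: insert.prems(2) sum.neutral_const)
    finally have "(\<Sum>k \<in> insert m K. ?ev k * g k x) - ?ev m * (\<Sum>k \<in> insert m K. g k x) = 0"
      by (simp only: insert.prems(2) mult_zero_right diff_zero)
    then have "(\<Sum>k \<in> insert m K. h k x) = 0"
      by (simp only: h_def left_diff_distrib sum_subtractf sum_distrib_left)
    then show ?thesis
      using insert.hyps by (simp add: h_def)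
  next
    case False
    then show ?thesis by (simp add: h_def off)
  qed
  ultimately have h0: "h k x = 0" if "k \<in> K" for k x
    using insert.IH that by blast
  have gK: "g k x = 0" if "k \<in> K" for k x
  proof -
    have "?ev k \<noteq> ?ev m"
      using that insert.hyps(2) assms(1) by (auto simp: hamming_eigenvalue_def)
    then show ?thesis using h0[OF that, of x] by (simp add: h_def)
  qed
  have "g m x = 0" for x
    using insert.prems(2)[of x] insert.hyps gK by simp
  then show ?case using insert.prems(3) gK by auto
qed

end

theory Submission
  imports Defs
begin

text \<open>
  Cut the \<open>(n + 1)\<close>-cube along its first coordinate, so that a function \<open>f\<close> on it becomes a pair
  of slices \<open>f\<^sub>0\<close>, \<open>f\<^sub>1\<close> on the \<open>n\<close>-cube. Each vertex has one neighbour across the cut and the rest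
  inside its own half, so the adjacency operator maps \<open>(f\<^sub>0, f\<^sub>1)\<close> to \<open>(A f\<^sub>0 + f\<^sub>1, A f\<^sub>1 + f\<^sub>0)\<close>, and it
  becomes diagonal in the coordinates \<open>f\<^sub>0 + f\<^sub>1\<close> and \<open>f\<^sub>0 - f\<^sub>1\<close>. In terms of eigenspaces: \<open>f\<close> lies
  in \<open>U\<^sub>k\<close> exactly if \<open>f\<^sub>0 + f\<^sub>1\<close> lies in \<open>U\<^sub>k\<close> and \<open>f\<^sub>0 - f\<^sub>1\<close> lies in \<open>U\<close> with index \<open>k - 1\<close>, which is
  the zero space if \<open>k = 0\<close> (\<open>cube_eigenspace_Suc_iff\<close>). Both halves of the theorem rest on this.

  The lower bound is the classical one for real multilinear polynomials of degree at most \<open>j\<close>,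
  which are the elements of \<open>U\<^sub>0 \<oplus> \<dots> \<oplus> U\<^sub>j\<close>
  (\<open>card_hamming_support_ge\<close>). In an induction on \<open>n\<close>, if both slices are nonzero, each has degree at most \<open>j\<close> and
  contributes at least \<open>2 ^ (n - j)\<close> points. If one of them vanishes, the other is, up to sign,
  \<open>f\<^sub>0 - f\<^sub>1\<close>, whose degree is at most \<open>j - 1\<close>, and it alone contributes twice as much.

  For sharpness, write \<open>\<chi>\<close> for the sign character on one coordinate. The
  function \<open>\<chi>(a) - \<chi>(b)\<close> of two coordinates is an eigenfunction of index 1 that vanishes on half of
  its points; the indicator of a single letter has components of index 0 and 1, and also vanishes
  on half of its points. A tensor product of \<open>i\<close> functions of the first kind, \<open>j - i\<close> of the second
  and constants on the remaining \<open>n - i - j\<close> coordinates has all its components between the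
  indices \<open>i\<close> and \<open>j\<close>, and each of the \<open>j\<close> nonconstant factors halves the support
  (\<open>bound_attained\<close>).
\<close>

section \<open>Slicing the cube along its first coordinate\<close>

lemma hamming_verts_0: "hamming_verts 0 q = {[]}"
  by (auto simp: hamming_verts_def)

lemma Cons_in_hamming_verts_iff:
  "a # x \<in> hamming_verts (Suc n) q \<longleftrightarrow> a < q \<and> x \<in> hamming_verts n q"
  by (auto simp: hamming_verts_def)

lemma hamming_verts_Suc:
  "hamming_verts (Suc n) 2 = Cons 0 ` hamming_verts n 2 \<union> Cons 1 ` hamming_verts n 2"
proof (rule set_eqI)
  fix w :: "nat list"
  show "w \<in> hamming_verts (Suc n) 2 \<longleftrightarrow>
      w \<in> Cons 0 ` hamming_verts n 2 \<union> Cons 1 ` hamming_verts n 2"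
  proof (cases w)
    case Nil
    then show ?thesis by (auto simp: hamming_verts_def)
  next
    case (Cons a x)
    then show ?thesis by (auto simp: Cons_in_hamming_verts_iff less_2_cases_iff)
  qed
qed

lemma hamming_adj_Cons_iff:
  assumes "length x = n" "length y = n"
  shows "hamming_adj (Suc n) (a # x) (b # y) \<longleftrightarrow> (if a = b then hamming_adj n x y else x = y)"
proof -
  let ?D = "{k. k < n \<and> x ! k \<noteq> y ! k}"
  have "{k. k < Suc n \<and> (a # x) ! k \<noteq> (b # y) ! k} = (if a = b then {} else {0}) \<union> Suc ` ?D"
    by (auto simp: less_Suc_eq_0_disj)
  moreover have "card ((if a = b then {} else {0}) \<union> Suc ` ?D) = (if a = b then 0 else 1) + card ?D"
    by (auto simp: card_insert_if card_image)
  moreover have "card ?D = 0 \<longleftrightarrow> x = y"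
    using assms by (auto simp: list_eq_iff_nth_eq)
  ultimately show ?thesis
    by (auto simp: hamming_adj_def)
qed

lemma hamming_nbrs_Cons:
  assumes "a < 2" "x \<in> hamming_verts n 2"
  shows "hamming_nbrs (Suc n) 2 (a # x) = insert ((1 - a) # x) (Cons a ` hamming_nbrs n 2 x)"
proof (rule set_eqI)
  fix w :: "nat list"
  have len: "length y = n" if "y \<in> hamming_verts n 2" for y
    using that by (simp add: hamming_verts_def)
  show "w \<in> hamming_nbrs (Suc n) 2 (a # x) \<longleftrightarrow>
      w \<in> insert ((1 - a) # x) (Cons a ` hamming_nbrs n 2 x)"
  proof (cases w)
    case Nil
    then show ?thesis by (auto simp: hamming_nbrs_def hamming_verts_def)
  next
    case (Cons b y)
    have "w \<in> hamming_nbrs (Suc n) 2 (a # x) \<longleftrightarrow>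
        b < 2 \<and> y \<in> hamming_verts n 2 \<and> (if a = b then hamming_adj n x y else x = y)"
      using hamming_adj_Cons_iff[OF len len, of x y a b] assms(2)
      by (auto simp: Cons hamming_nbrs_def Cons_in_hamming_verts_iff)
    also have "\<dots> \<longleftrightarrow> b = 1 - a \<and> y = x \<or> b = a \<and> y \<in> hamming_nbrs n 2 x"
    proof (cases "a = b")
      case True
      moreover have "a \<noteq> 1 - a" by presburger
      ultimately show ?thesis using assms by (auto simp: hamming_nbrs_def)
    next
      case False
      then have "b < 2 \<longleftrightarrow> b = 1 - a" using assms(1) by linarith
      then show ?thesis using False assms(2) by auto
    qed
    also have "\<dots> \<longleftrightarrow> w \<in> insert ((1 - a) # x) (Cons a ` hamming_nbrs n 2 x)"
      by (auto simp: Cons)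
    finally show ?thesis .
  qed
qed

lemma sum_hamming_nbrs_Cons:
  fixes f :: "nat list \<Rightarrow> real"
  assumes "a < 2" "x \<in> hamming_verts n 2"
  shows "(\<Sum>y \<in> hamming_nbrs (Suc n) 2 (a # x). f y)
      = f ((1 - a) # x) + (\<Sum>y \<in> hamming_nbrs n 2 x. f (a # y))"
proof -
  have "finite (hamming_nbrs n 2 x)"
    by (simp add: hamming_nbrs_def finite_hamming_verts)
  moreover have "(1 - a) # x \<notin> Cons a ` hamming_nbrs n 2 x"
    by clarsimp presburger
  ultimately show ?thesis
    by (simp add: hamming_nbrs_Cons[OF assms] sum.reindex)
qed

lemma hamming_funs_Suc_iff:
  "f \<in> hamming_funs (Suc n) 2 \<longleftrightarrow>
     f [] = 0 \<and> (\<forall>a x. a \<ge> 2 \<longrightarrow> f (a # x) = 0) \<and>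
     (\<lambda>x. f (0 # x)) \<in> hamming_funs n 2 \<and> (\<lambda>x. f (1 # x)) \<in> hamming_funs n 2"
  (is "?L \<longleftrightarrow> ?R")
proof
  assume ?L
  then show ?R
    by (auto simp: hamming_funs_def Cons_in_hamming_verts_iff) (auto simp: hamming_verts_def)
next
  assume R: ?R
  have "f w = 0" if "w \<notin> hamming_verts (Suc n) 2" for w
  proof (cases w)
    case Nil
    then show ?thesis using R by simp
  next
    case (Cons a x)
    consider "a = 0" | "a = 1" | "a \<ge> 2" by linarith
    then show ?thesis
      using R that unfolding Cons
      by cases (auto simp: hamming_funs_def Cons_in_hamming_verts_iff)
  qed
  then show ?L by (simp add: hamming_funs_def)
qed

lemma card_hamming_support_Suc:
  "card (hamming_support (Suc n) 2 f)
     = card (hamming_support n 2 (\<lambda>x. f (0 # x))) + card (hamming_support n 2 (\<lambda>x. f (1 # x)))"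
proof -
  let ?S = "\<lambda>a. hamming_support n 2 (\<lambda>x. f (a # x))"
  have "hamming_support (Suc n) 2 f = Cons 0 ` ?S 0 \<union> Cons 1 ` ?S 1"
    by (auto simp: hamming_support_def hamming_verts_Suc)
  moreover have "finite (?S a)" for a
    by (simp add: hamming_support_def finite_hamming_verts)
  moreover have "Cons 0 ` ?S 0 \<inter> Cons 1 ` ?S 1 = {}"
    by auto
  ultimately show ?thesis
    by (simp add: card_Un_disjoint card_image)
qed

section \<open>Eigenfunctions and their slices\<close>

text \<open>
  The eigenvalue is an arbitrary real number here, because slicing shifts it by \<open>\<plusminus>1\<close> and so can
  lead out of the spectrum; this is how the vanishing of \<open>f\<^sub>0 - f\<^sub>1\<close> for constant \<open>f\<close> shows up.
\<close>

definition cube_eigenspace :: "nat \<Rightarrow> real \<Rightarrow> (nat list \<Rightarrow> real) set" where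
  "cube_eigenspace n \<mu> =
     {f \<in> hamming_funs n 2. \<forall>x \<in> hamming_verts n 2. \<mu> * f x = (\<Sum>y \<in> hamming_nbrs n 2 x. f y)}"

lemma hamming_eigenspace_eq_cube:
  "hamming_eigenspace n 2 k = cube_eigenspace n (real n - 2 * real k)"
  by (simp add: hamming_eigenspace_def cube_eigenspace_def hamming_eigenvalue_def)

lemma cube_eigenspace_zero: "(\<lambda>_. 0) \<in> cube_eigenspace n \<mu>"
  by (simp add: cube_eigenspace_def hamming_funs_def)

lemma cube_eigenspace_add:
  "f \<in> cube_eigenspace n \<mu> \<Longrightarrow> g \<in> cube_eigenspace n \<mu> \<Longrightarrow>
     (\<lambda>x. f x + g x) \<in> cube_eigenspace n \<mu>"
  by (simp add: cube_eigenspace_def hamming_funs_def distrib_left sum.distrib)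

lemma cube_eigenspace_scale:
  "f \<in> cube_eigenspace n \<mu> \<Longrightarrow> (\<lambda>x. c * f x) \<in> cube_eigenspace n \<mu>"
  by (simp add: cube_eigenspace_def hamming_funs_def mult.left_commute flip: sum_distrib_left)

text \<open>
  The swap of the two halves has eigenvalue 1 on symmetric and \<open>-1\<close> on antisymmetric functions,
  and the adjacency operator is its sum with the operators of the halves.
\<close>

lemma cube_eigenspace_Suc_iff:
  assumes "f \<in> hamming_funs (Suc n) 2"
  shows "f \<in> cube_eigenspace (Suc n) \<mu> \<longleftrightarrow>
    (\<lambda>x. f (0 # x) + f (1 # x)) \<in> cube_eigenspace n (\<mu> - 1) \<and>
    (\<lambda>x. f (0 # x) - f (1 # x)) \<in> cube_eigenspace n (\<mu> + 1)"
proof -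
  let ?A = "\<lambda>a x. \<Sum>y \<in> hamming_nbrs n 2 x. f (a # y)"
  have "f \<in> cube_eigenspace (Suc n) \<mu> \<longleftrightarrow> (\<forall>x \<in> hamming_verts n 2.
      \<mu> * f (0 # x) = f (1 # x) + ?A 0 x \<and> \<mu> * f (1 # x) = f (0 # x) + ?A 1 x)"
    using assms by (auto simp: cube_eigenspace_def hamming_verts_Suc sum_hamming_nbrs_Cons)
  also have "\<dots> \<longleftrightarrow> (\<forall>x \<in> hamming_verts n 2.
      (\<mu> - 1) * (f (0 # x) + f (1 # x)) = ?A 0 x + ?A 1 x \<and>
      (\<mu> + 1) * (f (0 # x) - f (1 # x)) = ?A 0 x - ?A 1 x)"
  proof (intro ball_cong refl)
    fix x
    have "\<mu> * p = q + A \<and> \<mu> * q = p + B \<longleftrightarrow>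
        (\<mu> - 1) * (p + q) = A + B \<and> (\<mu> + 1) * (p - q) = A - B" for p q A B :: real
      by (simp add: algebra_simps) linarith
    then show "\<mu> * f (0 # x) = f (1 # x) + ?A 0 x \<and> \<mu> * f (1 # x) = f (0 # x) + ?A 1 x \<longleftrightarrow>
      (\<mu> - 1) * (f (0 # x) + f (1 # x)) = ?A 0 x + ?A 1 x \<and>
      (\<mu> + 1) * (f (0 # x) - f (1 # x)) = ?A 0 x - ?A 1 x" .
  qed
  also have "\<dots> \<longleftrightarrow> (\<lambda>x. f (0 # x) + f (1 # x)) \<in> cube_eigenspace n (\<mu> - 1) \<and>
      (\<lambda>x. f (0 # x) - f (1 # x)) \<in> cube_eigenspace n (\<mu> + 1)"
    using assms unfolding hamming_funs_Suc_iff
    by (auto simp: cube_eigenspace_def hamming_funs_def sum.distrib sum_subtractf)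
  finally show ?thesis .
qed

lemma cube_eigenspace_SucD:
  assumes "f \<in> cube_eigenspace (Suc n) \<mu>"
  shows "(\<lambda>x. f (0 # x) + f (1 # x)) \<in> cube_eigenspace n (\<mu> - 1)"
    and "(\<lambda>x. f (0 # x) - f (1 # x)) \<in> cube_eigenspace n (\<mu> + 1)"
  using assms cube_eigenspace_Suc_iff[of f n \<mu>] by (simp_all add: cube_eigenspace_def)

text \<open>
  No eigenvalue exceeds the valency: slicing preserves the hypothesis \<open>\<mu> > n\<close>, since \<open>\<mu> - 1 > n - 1\<close>,
  and the operator of the \<open>0\<close>-cube is zero.
\<close>

lemma cube_eigenspace_above_valency:
  "f \<in> cube_eigenspace n \<mu> \<Longrightarrow> \<mu> > real n \<Longrightarrow> x \<in> hamming_verts n 2 \<Longrightarrow> f x = 0"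
proof (induction n arbitrary: f \<mu> x)
  case 0
  have "hamming_nbrs 0 2 [] = {}"
    by (simp add: hamming_nbrs_def hamming_adj_def)
  then show ?case
    using 0 by (simp add: cube_eigenspace_def hamming_verts_0)
next
  case (Suc n)
  note S = cube_eigenspace_SucD[OF Suc.prems(1)]
  have "f (0 # y) + f (1 # y) = 0 \<and> f (0 # y) - f (1 # y) = 0"
    if "y \<in> hamming_verts n 2" for y
    using Suc.IH[OF S(1) _ that] Suc.IH[OF S(2) _ that] Suc.prems(2) by simp
  then have "f (0 # y) = 0 \<and> f (1 # y) = 0" if "y \<in> hamming_verts n 2" for y
    using that by fastforce
  then show ?case
    using Suc.prems(3) by (auto simp: hamming_verts_Suc)
qed

section \<open>Sums of consecutive eigenspaces\<close>

lemma hamming_eigensumI: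
  assumes "\<And>k. k \<in> {i..j} \<Longrightarrow> g k \<in> hamming_eigenspace n q k"
    and "\<And>x. f x = (\<Sum>k \<in> {i..j}. g k x)"
  shows "f \<in> hamming_eigensum n q i j"
  using assms unfolding hamming_eigensum_def by blast

lemma hamming_eigensumE:
  assumes "f \<in> hamming_eigensum n q i j"
  obtains g where "\<And>k. k \<in> {i..j} \<Longrightarrow> g k \<in> hamming_eigenspace n q k"
    and "\<And>x. f x = (\<Sum>k \<in> {i..j}. g k x)"
proof -
  obtain g where "\<forall>k \<in> {i..j}. g k \<in> hamming_eigenspace n q k" "f = (\<lambda>x. \<Sum>k \<in> {i..j}. g k x)"
    using assms unfolding hamming_eigensum_def by blast
  then show thesis
    by (intro that[of g]) simp_all
qed

lemma hamming_eigensum_funs: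
  assumes "f \<in> hamming_eigensum n q i j"
  shows "f \<in> hamming_funs n q"
  using assms by (auto elim!: hamming_eigensumE simp: hamming_eigenspace_def hamming_funs_def)

lemma hamming_eigensum_mono:
  assumes "f \<in> hamming_eigensum n 2 i j" "i' \<le> i" "j \<le> j'"
  shows "f \<in> hamming_eigensum n 2 i' j'"
proof -
  obtain g where g: "\<And>k. k \<in> {i..j} \<Longrightarrow> g k \<in> hamming_eigenspace n 2 k"
    "\<And>x. f x = (\<Sum>k \<in> {i..j}. g k x)"
    using assms(1) by (rule hamming_eigensumE) blast
  show ?thesis
  proof (rule hamming_eigensumI[where g = "\<lambda>k x. if k \<in> {i..j} then g k x else 0"])
    show "(\<lambda>x. if k \<in> {i..j} then g k x else 0) \<in> hamming_eigenspace n 2 k" for k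
      using g(1)[of k] cube_eigenspace_zero[of n "real n - 2 * real k"]
      by (cases "k \<in> {i..j}") (auto simp: hamming_eigenspace_eq_cube)
    show "f x = (\<Sum>k \<in> {i'..j'}. if k \<in> {i..j} then g k x else 0)" for x
      unfolding g(2) using assms(2,3) by (intro sum.mono_neutral_cong_left) auto
  qed
qed

lemma hamming_eigensum_add:
  assumes "f \<in> hamming_eigensum n 2 i j" "f' \<in> hamming_eigensum n 2 i j"
  shows "(\<lambda>x. f x + f' x) \<in> hamming_eigensum n 2 i j"
proof -
  obtain g where "\<And>k. k \<in> {i..j} \<Longrightarrow> g k \<in> hamming_eigenspace n 2 k"
    "\<And>x. f x = (\<Sum>k \<in> {i..j}. g k x)"
    using assms(1) by (rule hamming_eigensumE) blast
  moreover obtain g' where "\<And>k. k \<in> {i..j} \<Longrightarrow> g' k \<in> hamming_eigenspace n 2 k"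
    "\<And>x. f' x = (\<Sum>k \<in> {i..j}. g' k x)"
    using assms(2) by (rule hamming_eigensumE) blast
  ultimately show ?thesis
    by (intro hamming_eigensumI[where g = "\<lambda>k x. g k x + g' k x"])
      (simp_all add: hamming_eigenspace_eq_cube cube_eigenspace_add sum.distrib)
qed

lemma hamming_eigensum_scale:
  assumes "f \<in> hamming_eigensum n 2 i j"
  shows "(\<lambda>x. c * f x) \<in> hamming_eigensum n 2 i j"
proof -
  obtain g where "\<And>k. k \<in> {i..j} \<Longrightarrow> g k \<in> hamming_eigenspace n 2 k"
    "\<And>x. f x = (\<Sum>k \<in> {i..j}. g k x)"
    using assms by (rule hamming_eigensumE) blast
  then show ?thesis
    by (intro hamming_eigensumI[where g = "\<lambda>k x. c * g k x"])
      (simp_all add: hamming_eigenspace_eq_cube cube_eigenspace_scale sum_distrib_left)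
qed

section \<open>The lower bound\<close>

lemma hamming_eigensum_slice_sum:
  assumes "f \<in> hamming_eigensum (Suc n) 2 i j"
  shows "(\<lambda>x. f (0 # x) + f (1 # x)) \<in> hamming_eigensum n 2 i j"
proof -
  obtain g where g: "\<And>k. k \<in> {i..j} \<Longrightarrow> g k \<in> hamming_eigenspace (Suc n) 2 k"
    "\<And>x. f x = (\<Sum>k \<in> {i..j}. g k x)"
    using assms by (rule hamming_eigensumE) blast
  show ?thesis
  proof (rule hamming_eigensumI[where g = "\<lambda>k x. g k (0 # x) + g k (1 # x)"])
    fix k assume "k \<in> {i..j}"
    then show "(\<lambda>x. g k (0 # x) + g k (1 # x)) \<in> hamming_eigenspace n 2 k"
      using cube_eigenspace_SucD(1)[of "g k" n "real (Suc n) - 2 * real k"] g(1)[of k]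
      by (simp add: hamming_eigenspace_eq_cube)
  qed (simp add: g(2) sum.distrib)
qed

lemma hamming_eigensum_slice_diff_0:
  assumes "f \<in> hamming_eigensum (Suc n) 2 0 0" "x \<in> hamming_verts n 2"
  shows "f (0 # x) = f (1 # x)"
proof -
  have "f \<in> cube_eigenspace (Suc n) (real (Suc n))"
    using assms(1) by (auto simp: hamming_eigensum_def hamming_eigenspace_eq_cube)
  from cube_eigenspace_above_valency[OF cube_eigenspace_SucD(2)[OF this] _ assms(2)]
  show ?thesis by simp
qed

text \<open>
  The difference kills the component of index 0, and lowers the index of all others by one.
\<close>

lemma hamming_eigensum_slice_diff:
  assumes "f \<in> hamming_eigensum (Suc n) 2 0 (Suc d)"
  shows "(\<lambda>x. f (0 # x) - f (1 # x)) \<in> hamming_eigensum n 2 0 d"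
proof -
  obtain g where g: "\<And>k. k \<in> {0..Suc d} \<Longrightarrow> g k \<in> hamming_eigenspace (Suc n) 2 k"
    "\<And>x. f x = (\<Sum>k \<in> {0..Suc d}. g k x)"
    using assms by (rule hamming_eigensumE) blast
  have D: "(\<lambda>x. g k (0 # x) - g k (1 # x)) \<in> cube_eigenspace n (real n + 2 - 2 * real k)"
    if "k \<le> Suc d" for k
    using cube_eigenspace_SucD(2)[of "g k" n "real (Suc n) - 2 * real k"] g(1)[of k] that
    by (simp add: hamming_eigenspace_eq_cube algebra_simps)
  have g0: "g 0 (0 # x) - g 0 (1 # x) = 0" for x
  proof (cases "x \<in> hamming_verts n 2")
    case True
    then show ?thesis
      using cube_eigenspace_above_valency[OF D[of 0]] by simp
  next
    case False
    then show ?thesis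
      using D[of 0] by (simp add: cube_eigenspace_def hamming_funs_def)
  qed
  show ?thesis
  proof (rule hamming_eigensumI[where g = "\<lambda>k x. g (Suc k) (0 # x) - g (Suc k) (1 # x)"])
    fix k assume "k \<in> {0..d}"
    then show "(\<lambda>x. g (Suc k) (0 # x) - g (Suc k) (1 # x)) \<in> hamming_eigenspace n 2 k"
      using D[of "Suc k"] by (simp add: hamming_eigenspace_eq_cube)
  next
    fix x
    have "f (0 # x) - f (1 # x) = (\<Sum>k = 0..Suc d. g k (0 # x) - g k (1 # x))"
      by (simp only: g(2) sum_subtractf)
    also have "\<dots> = (\<Sum>k = 0..d. g (Suc k) (0 # x) - g (Suc k) (1 # x))"
      using g0 by (simp only: sum.atLeast0_atMost_Suc_shift comp_def add_0)
    finally show "f (0 # x) - f (1 # x) = (\<Sum>k = 0..d. g (Suc k) (0 # x) - g (Suc k) (1 # x))" .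
  qed
qed

lemma hamming_eigensum_slice:
  assumes "f \<in> hamming_eigensum (Suc n) 2 0 d"
  shows "(\<lambda>x. f (0 # x)) \<in> hamming_eigensum n 2 0 d" "(\<lambda>x. f (1 # x)) \<in> hamming_eigensum n 2 0 d"
proof -
  note s = hamming_eigensum_slice_sum[OF assms]
  have d: "(\<lambda>x. f (0 # x) - f (1 # x)) \<in> hamming_eigensum n 2 0 d"
  proof (cases d)
    case 0
    \<comment> \<open>The difference is zero, and zero is a multiple of the sum.\<close>
    have "f (0 # x) - f (1 # x) = 0 * (f (0 # x) + f (1 # x))" for x
      using hamming_eigensum_slice_diff_0[of f n x] assms hamming_eigensum_funs[OF assms] unfolding 0 hamming_funs_Suc_iff
      by (cases "x \<in> hamming_verts n 2") (auto simp: hamming_funs_def)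
    then show ?thesis
      using hamming_eigensum_scale[OF s, of 0] by presburger
  next
    case (Suc d')
    then show ?thesis
      using hamming_eigensum_slice_diff[of f n d'] assms
      by (auto intro: hamming_eigensum_mono)
  qed
  show "(\<lambda>x. f (0 # x)) \<in> hamming_eigensum n 2 0 d"
    using hamming_eigensum_scale[OF hamming_eigensum_add[OF s d], of "1/2"] by simp
  show "(\<lambda>x. f (1 # x)) \<in> hamming_eigensum n 2 0 d"
    using hamming_eigensum_scale[OF hamming_eigensum_add[OF s hamming_eigensum_scale[OF d, of "-1"]],
        of "1/2"] by simp
qed

theorem card_hamming_support_ge:
  "f \<in> hamming_eigensum n 2 0 d \<Longrightarrow> x \<in> hamming_verts n 2 \<Longrightarrow> f x \<noteq> 0 \<Longrightarrow>
     2 ^ (n - d) \<le> card (hamming_support n 2 f)"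
proof (induction n arbitrary: f d x)
  case 0
  then have "hamming_support 0 2 f = {[]}"
    by (auto simp: hamming_support_def hamming_verts_0)
  then show ?case by simp
next
  case (Suc n)
  let ?f0 = "\<lambda>x. f (0 # x)" and ?f1 = "\<lambda>x. f (1 # x)"
  have slices: "?f0 \<in> hamming_eigensum n 2 0 d" "?f1 \<in> hamming_eigensum n 2 0 d"
    using hamming_eigensum_slice[OF Suc.prems(1)] by blast+
  have nonzero: "\<exists>y \<in> hamming_verts n 2. f (0 # y) \<noteq> 0 \<or> f (1 # y) \<noteq> 0"
    using Suc.prems(2,3) by (auto simp: hamming_verts_Suc)
  consider (both) y z where "y \<in> hamming_verts n 2" "f (0 # y) \<noteq> 0"
      "z \<in> hamming_verts n 2" "f (1 # z) \<noteq> 0"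
    | (one) "(\<forall>y \<in> hamming_verts n 2. f (0 # y) = 0) \<or> (\<forall>y \<in> hamming_verts n 2. f (1 # y) = 0)"
    by blast
  then show ?case
  proof cases
    case both
    have "2 ^ (Suc n - d) \<le> (2 ^ Suc (n - d) :: nat)"
      by (rule power_increasing) auto
    also have "\<dots> = 2 ^ (n - d) + 2 ^ (n - d)"
      by simp
    also have "\<dots> \<le> card (hamming_support n 2 ?f0) + card (hamming_support n 2 ?f1)"
      using Suc.IH[OF slices(1) both(1,2)] Suc.IH[OF slices(2) both(3,4)] by (rule add_mono)
    finally show ?thesis
      by (simp add: card_hamming_support_Suc)
  next
    case one
    \<comment> \<open>The difference agrees up to sign with the surviving slice, so its support is no larger than
      that of \<open>f\<close>; being nonzero, it forces \<open>d\<close> to be positive.\<close>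
    then obtain y where y: "y \<in> hamming_verts n 2" "f (0 # y) \<noteq> f (1 # y)"
      using nonzero by force
    then obtain d' where d: "d = Suc d'"
      using hamming_eigensum_slice_diff_0[of f n y] Suc.prems(1) by (cases d) auto
    have "2 ^ (n - d') \<le> card (hamming_support n 2 (\<lambda>x. f (0 # x) - f (1 # x)))"
      using hamming_eigensum_slice_diff[of f n d'] Suc.prems(1) y d by (intro Suc.IH[where x = y]) auto
    also have "hamming_support n 2 (\<lambda>x. f (0 # x) - f (1 # x))
        \<subseteq> hamming_support n 2 ?f0 \<union> hamming_support n 2 ?f1"
      by (auto simp: hamming_support_def)
    then have "card (hamming_support n 2 (\<lambda>x. f (0 # x) - f (1 # x)))
        \<le> card (hamming_support n 2 ?f0 \<union> hamming_support n 2 ?f1)"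
      by (intro card_mono) (auto simp: hamming_support_def finite_hamming_verts)
    also have "\<dots> \<le> card (hamming_support n 2 ?f0) + card (hamming_support n 2 ?f1)"
      by (rule card_Un_le)
    finally show ?thesis
      by (simp add: card_hamming_support_Suc d)
  qed
qed

section \<open>Functions attaining the bound\<close>

definition cube_join :: "(nat list \<Rightarrow> real) \<Rightarrow> (nat list \<Rightarrow> real) \<Rightarrow> nat list \<Rightarrow> real" where
  "cube_join g h w =
     (case w of [] \<Rightarrow> 0 | a # x \<Rightarrow> if a = 0 then g x else if a = 1 then h x else 0)"

lemma cube_join_simps [simp]:
  "cube_join g h [] = 0"
  "cube_join g h (0 # x) = g x"
  "cube_join g h (Suc 0 # x) = h x"
  by (simp_all add: cube_join_def)

lemma cube_join_sum:
  "cube_join (\<lambda>x. \<Sum>k \<in> K. g k x) (\<lambda>x. \<Sum>k \<in> K. h k x) w = (\<Sum>k \<in> K. cube_join (g k) (h k) w)"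
  by (auto simp: cube_join_def split: list.split)

lemma cube_join_add:
  "cube_join g h w + cube_join g' h' w = cube_join (\<lambda>x. g x + g' x) (\<lambda>x. h x + h' x) w"
  by (auto simp: cube_join_def split: list.split)

lemma cube_join_scale: "c * cube_join g h w = cube_join (\<lambda>x. c * g x) (\<lambda>x. c * h x) w"
  by (auto simp: cube_join_def split: list.split)

lemma cube_join_funs:
  "g \<in> hamming_funs n 2 \<Longrightarrow> h \<in> hamming_funs n 2 \<Longrightarrow> cube_join g h \<in> hamming_funs (Suc n) 2"
  by (simp add: hamming_funs_Suc_iff) (simp add: cube_join_def)

lemma card_hamming_support_join:
  "card (hamming_support (Suc n) 2 (cube_join g h))
     = card (hamming_support n 2 g) + card (hamming_support n 2 h)"
  by (simp add: card_hamming_support_Suc)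

lemma card_hamming_support_zero: "card (hamming_support n q (\<lambda>_. 0)) = 0"
  by (simp add: hamming_support_def)

lemma cube_eigenspace_join_const:
  assumes "f \<in> cube_eigenspace n \<mu>"
  shows "cube_join f f \<in> cube_eigenspace (Suc n) (\<mu> + 1)"
proof -
  have "cube_join f f \<in> hamming_funs (Suc n) 2"
    using assms by (simp add: cube_join_funs cube_eigenspace_def)
  then show ?thesis
    using cube_eigenspace_scale[OF assms, of 2]
    by (simp add: cube_eigenspace_Suc_iff cube_eigenspace_zero)
qed

lemma cube_eigenspace_join_sign:
  assumes "f \<in> cube_eigenspace n \<mu>"
  shows "cube_join f (\<lambda>x. - f x) \<in> cube_eigenspace (Suc n) (\<mu> - 1)"
proof -
  have "cube_join f (\<lambda>x. - f x) \<in> hamming_funs (Suc n) 2"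
    using assms cube_eigenspace_scale[OF assms, of "-1"]
    by (simp add: cube_join_funs cube_eigenspace_def)
  then show ?thesis
    using cube_eigenspace_scale[OF assms, of 2]
    by (simp add: cube_eigenspace_Suc_iff cube_eigenspace_zero)
qed

lemma hamming_eigensum_join_const:
  assumes "f \<in> hamming_eigensum n 2 i j"
  shows "cube_join f f \<in> hamming_eigensum (Suc n) 2 i j"
proof -
  obtain g where g: "\<And>k. k \<in> {i..j} \<Longrightarrow> g k \<in> hamming_eigenspace n 2 k"
    "\<And>x. f x = (\<Sum>k \<in> {i..j}. g k x)"
    using assms by (rule hamming_eigensumE) blast
  have f: "f = (\<lambda>x. \<Sum>k \<in> {i..j}. g k x)"
    using g(2) by (rule ext)
  show ?thesis
  proof (rule hamming_eigensumI[where g = "\<lambda>k. cube_join (g k) (g k)"])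
    fix k assume "k \<in> {i..j}"
    then show "cube_join (g k) (g k) \<in> hamming_eigenspace (Suc n) 2 k"
      using cube_eigenspace_join_const[of "g k" n "real n - 2 * real k"] g(1)[of k]
      by (simp add: hamming_eigenspace_eq_cube algebra_simps)
  qed (simp add: f cube_join_sum)
qed

lemma hamming_eigensum_join_sign:
  assumes "f \<in> hamming_eigensum n 2 i j"
  shows "cube_join f (\<lambda>x. - f x) \<in> hamming_eigensum (Suc n) 2 (Suc i) (Suc j)"
proof -
  obtain g where g: "\<And>k. k \<in> {i..j} \<Longrightarrow> g k \<in> hamming_eigenspace n 2 k"
    "\<And>x. f x = (\<Sum>k \<in> {i..j}. g k x)"
    using assms by (rule hamming_eigensumE) blast
  have f: "f = (\<lambda>x. \<Sum>k \<in> {i..j}. g k x)"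
    using g(2) by (rule ext)
  let ?h = "\<lambda>k. cube_join (g k) (\<lambda>x. - g k x)"
  show ?thesis
  proof (rule hamming_eigensumI[where g = "\<lambda>k. ?h (k - 1)"])
    fix k assume "k \<in> {Suc i..Suc j}"
    then obtain m where m: "k = Suc m" "m \<in> {i..j}"
      by (cases k) auto
    then show "?h (k - 1) \<in> hamming_eigenspace (Suc n) 2 k"
      using cube_eigenspace_join_sign[of "g m" n "real n - 2 * real m"] g(1)[of m]
      by (simp add: hamming_eigenspace_eq_cube algebra_simps)
  next
    fix w
    have "cube_join f (\<lambda>x. - f x) w = (\<Sum>k \<in> {i..j}. ?h k w)"
      unfolding f by (simp only: cube_join_sum flip: sum_negf)
    also have "\<dots> = (\<Sum>k \<in> {Suc i..Suc j}. ?h (k - 1) w)"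
      by (simp only: sum.shift_bounds_cl_Suc_ivl diff_Suc_1)
    finally show "cube_join f (\<lambda>x. - f x) w = (\<Sum>k \<in> {Suc i..Suc j}. ?h (k - 1) w)" .
  qed
qed

text \<open>
  The indicator of the letter 0 is the average of the constant 1 and the sign character.
\<close>

lemma hamming_eigensum_join_indicator:
  assumes "f \<in> hamming_eigensum n 2 i j"
  shows "cube_join f (\<lambda>_. 0) \<in> hamming_eigensum (Suc n) 2 i (Suc j)"
proof -
  have "cube_join f f \<in> hamming_eigensum (Suc n) 2 i (Suc j)"
    using hamming_eigensum_join_const[OF assms] by (rule hamming_eigensum_mono) auto
  moreover have "cube_join f (\<lambda>x. - f x) \<in> hamming_eigensum (Suc n) 2 i (Suc j)"
    using hamming_eigensum_join_sign[OF assms] by (rule hamming_eigensum_mono) auto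
  ultimately have "(\<lambda>w. (1/2) * (cube_join f f w + cube_join f (\<lambda>x. - f x) w))
      \<in> hamming_eigensum (Suc n) 2 i (Suc j)"
    by (intro hamming_eigensum_scale hamming_eigensum_add)
  then show ?thesis
    by (simp add: cube_join_add cube_join_scale flip: mult.assoc)
qed

text \<open>
  The function is \<open>(\<chi>(b) - \<chi>(a)) f(x) / 2\<close> at \<open>a # b # x\<close>: two tensor products
  of \<open>f\<close> with one constant and one sign factor. Only the words with \<open>a \<noteq> b\<close> remain in the support,
  while both indices go up by one.
\<close>

lemma hamming_eigensum_join_pair:
  assumes "f \<in> hamming_eigensum n 2 i j"
  shows "cube_join (cube_join (\<lambda>_. 0) (\<lambda>x. - f x)) (cube_join f (\<lambda>_. 0))
    \<in> hamming_eigensum (Suc (Suc n)) 2 (Suc i) (Suc j)"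
proof -
  let ?c = "cube_join f f" and ?s = "cube_join f (\<lambda>x. - f x)"
  have "cube_join ?s ?s \<in> hamming_eigensum (Suc (Suc n)) 2 (Suc i) (Suc j)"
    "cube_join ?c (\<lambda>x. - ?c x) \<in> hamming_eigensum (Suc (Suc n)) 2 (Suc i) (Suc j)"
    using hamming_eigensum_join_const[OF hamming_eigensum_join_sign[OF assms]]
      hamming_eigensum_join_sign[OF hamming_eigensum_join_const[OF assms]] .
  then have "(\<lambda>w. (1/2) * (cube_join ?s ?s w + (-1) * cube_join ?c (\<lambda>x. - ?c x) w))
      \<in> hamming_eigensum (Suc (Suc n)) 2 (Suc i) (Suc j)"
    by (intro hamming_eigensum_scale hamming_eigensum_add)
  also have "(\<lambda>w. (1/2) * (cube_join ?s ?s w + (-1) * cube_join ?c (\<lambda>x. - ?c x) w))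
      = cube_join (cube_join (\<lambda>_. 0) (\<lambda>x. - f x)) (cube_join f (\<lambda>_. 0))"
    by (auto simp: cube_join_def fun_eq_iff split: list.split)
  finally show ?thesis .
qed

definition bound_attained :: "nat \<Rightarrow> nat \<Rightarrow> nat \<Rightarrow> bool" where
  "bound_attained n i j \<longleftrightarrow>
     (\<exists>f \<in> hamming_eigensum n 2 i j. card (hamming_support n 2 f) = 2 ^ (n - j))"

lemma bound_attained_0: "bound_attained 0 0 0"
proof -
  let ?e = "\<lambda>x :: nat list. if x = [] then 1 else 0 :: real"
  have "?e \<in> hamming_eigenspace 0 2 0"
    by (simp add: hamming_eigenspace_def hamming_funs_def hamming_verts_0 hamming_eigenvalue_def
        hamming_nbrs_def hamming_adj_def)
  then have "?e \<in> hamming_eigensum 0 2 0 0"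
    by (intro hamming_eigensumI[where g = "\<lambda>_. ?e"]) auto
  moreover have "hamming_support 0 2 ?e = {[]}"
    by (auto simp: hamming_support_def hamming_verts_0)
  ultimately show ?thesis
    unfolding bound_attained_def by (intro bexI[of _ ?e]) simp_all
qed

lemma bound_attained_const:
  assumes "bound_attained n i j" "j \<le> n"
  shows "bound_attained (Suc n) i j"
proof -
  obtain f where f: "f \<in> hamming_eigensum n 2 i j" "card (hamming_support n 2 f) = 2 ^ (n - j)"
    using assms(1) by (auto simp: bound_attained_def)
  show ?thesis
    unfolding bound_attained_def using f(2) assms(2)
    by (intro bexI[OF _ hamming_eigensum_join_const[OF f(1)]])
      (simp add: card_hamming_support_join Suc_diff_le)
qed

lemma bound_attained_indicator:
  assumes "bound_attained n i j"
  shows "bound_attained (Suc n) i (Suc j)"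
proof -
  obtain f where f: "f \<in> hamming_eigensum n 2 i j" "card (hamming_support n 2 f) = 2 ^ (n - j)"
    using assms by (auto simp: bound_attained_def)
  show ?thesis
    unfolding bound_attained_def using f(2)
    by (intro bexI[OF _ hamming_eigensum_join_indicator[OF f(1)]])
      (simp add: card_hamming_support_join card_hamming_support_zero)
qed

lemma bound_attained_pair:
  assumes "bound_attained n i j" "j \<le> n"
  shows "bound_attained (Suc (Suc n)) (Suc i) (Suc j)"
proof -
  obtain f where f: "f \<in> hamming_eigensum n 2 i j" "card (hamming_support n 2 f) = 2 ^ (n - j)"
    using assms(1) by (auto simp: bound_attained_def)
  have "hamming_support n 2 (\<lambda>x. - f x) = hamming_support n 2 f"
    by (simp add: hamming_support_def)
  then show ?thesis
    unfolding bound_attained_def using f(2) assms(2)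
    by (intro bexI[OF _ hamming_eigensum_join_pair[OF f(1)]])
      (simp add: card_hamming_support_join card_hamming_support_zero Suc_diff_le)
qed

theorem bound_attained:
  assumes "i \<le> j" "i + j \<le> n"
  shows "bound_attained n i j"
proof -
  have pairs: "bound_attained (i + i) i i"
  proof (induction i)
    case 0
    show ?case using bound_attained_0 by simp
  next
    case (Suc i)
    then show ?case using bound_attained_pair[of "i + i" i i] by simp
  qed
  have indicators: "bound_attained (i + j) i j"
    using assms(1)
  proof (induction j rule: dec_induct)
    case base
    show ?case by (rule pairs)
  next
    case (step m)
    then show ?case using bound_attained_indicator[of "i + m" i m] by simp
  qed
  show ?thesis
    using assms(2)
  proof (induction n rule: dec_induct)
    case base
    show ?case by (rule indicators)
  next
    case (step m)
    then show ?case using bound_attained_const[of m i j] by simp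
  qed
qed

theorem theorem3:
  fixes n i j :: nat
  assumes "n \<ge> 1" and "i \<le> j" and "j \<le> n" and "i + j \<le> n"
  shows "(\<forall>f \<in> hamming_eigensum n 2 i j. (\<exists>x \<in> hamming_verts n 2. f x \<noteq> 0) \<longrightarrow>
            card (hamming_support n 2 f) \<ge> 2 ^ (n - j)) \<and>
         (\<exists>f \<in> hamming_eigensum n 2 i j. (\<exists>x \<in> hamming_verts n 2. f x \<noteq> 0) \<and>
            card (hamming_support n 2 f) = 2 ^ (n - j))"
proof (intro conjI ballI impI)
  fix f
  assume "f \<in> hamming_eigensum n 2 i j" and "\<exists>x \<in> hamming_verts n 2. f x \<noteq> 0"
  then show "card (hamming_support n 2 f) \<ge> 2 ^ (n - j)"
    using card_hamming_support_ge hamming_eigensum_mono[of f n i j 0 j] by blast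
next
  obtain f where f: "f \<in> hamming_eigensum n 2 i j" "card (hamming_support n 2 f) = 2 ^ (n - j)"
    using bound_attained[OF assms(2,4)] by (auto simp: bound_attained_def)
  then have "hamming_support n 2 f \<noteq> {}"
    by fastforce
  then have "\<exists>x \<in> hamming_verts n 2. f x \<noteq> 0"
    by (auto simp: hamming_support_def)
  with f show "\<exists>f \<in> hamming_eigensum n 2 i j. (\<exists>x \<in> hamming_verts n 2. f x \<noteq> 0) \<and>
      card (hamming_support n 2 f) = 2 ^ (n - j)"
    by blast
qed

end
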